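(* Let $F$ be a field, let $z$ be a positive integer, and let $q,Q>1$ be integers coprime to $z$ whose residue classes generate the same subgroup, of order $n$ say, of the group $(\mathbb{Z}/z\mathbb{Z})^\times$ of prime residues modulo $z$. Then the $F$-algebras $A[q,n,z]$ and $A[Q,n,z]$ are isomorphic. In particular, if $q\equiv Q\pmod z$ then $A[q,n,z]\cong A[Q,n,z]$.
   Context: $\mathbb{N}$ denotes the set of positive integers. For a field $F$ and $q,n,e\in\mathbb{N}$ with $q>1$ and $e\mid q^n-1$, let $I=(X_1^q,\dots,X_n^q)$ in the polynomial algebra $F[X_1,\dots,X_n]$ and $x_j=X_j+I$. Then $A(q,n,e)$ is the unital $F$-subalgebra of $F[x_1,\dots,x_n]=F[X_1,\dots,X_n]/I$ generated by all monomials $x_1^{i_1}\cdots x_n^{i_n}$ with $i_1+qi_2+\dots+q^{n-1}i_n\equiv 0\pmod e$. For $q,n,z\in\mathbb{N}$ with $q>1$ and $z\mid q^n-1$, one writes $A[q,n,z]:=A(q,n,(q^n-1)/z)$. *)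

theory Defs
  imports
    "HOL-Algebra.Algebra"
    "HOL-Algebra.Algebraic_Closure_Type"
    "HOL-Library.Poly_Mapping"
    "HOL-Number_Theory.Cong"
begin

section \<open>Quotients, subalgebras and isomorphisms of algebras\<close>

definition quot_algebra :: "('a, 'b) module \<Rightarrow> 'b set \<Rightarrow> ('a, 'b set) module"
  where "quot_algebra M I =
    \<lparr>carrier = carrier (M Quot I), monoid.mult = monoid.mult (M Quot I),
     one = one (M Quot I), ring.zero = ring.zero (M Quot I), add = add (M Quot I),
     module.smult = (\<lambda>c A. \<Union>x\<in>A. I +>\<^bsub>M\<^esub> (c \<odot>\<^bsub>M\<^esub> x))\<rparr>"

definition gen_subalgebra :: "'a ring \<Rightarrow> ('a, 'b) module \<Rightarrow> 'b set \<Rightarrow> 'b set"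
  where "gen_subalgebra R M S = \<Inter>{B. submodule B R M \<and> subring B M \<and> S \<subseteq> B}"

definition algebra_isomorphic :: "'a ring \<Rightarrow> ('a, 'b) module \<Rightarrow> ('a, 'c) module \<Rightarrow> bool"
  where "algebra_isomorphic R A B \<longleftrightarrow>
    (\<exists>h \<in> ring_iso A B. \<forall>c\<in>carrier R. \<forall>x\<in>carrier A. h (c \<odot>\<^bsub>A\<^esub> x) = c \<odot>\<^bsub>B\<^esub> h x)"


section \<open>The truncated polynomial algebra\<close>

text \<open>Exponent vectors are finitely supported maps from variable indices to \<^typ>\<open>nat\<close>, polynomials
  are finitely supported maps from exponent vectors to coefficients (with convolution product).
  \<open>mpoly_algebra n\<close> consists of those that involve the variables \<open>X\<^sub>1, \<dots>, X\<^sub>n\<close> only.\<close>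

type_synonym 'a mpoly = "(nat \<Rightarrow>\<^sub>0 nat) \<Rightarrow>\<^sub>0 'a"

definition mvar :: "nat \<Rightarrow> 'a::field mpoly"
  where "mvar j = Poly_Mapping.single (Poly_Mapping.single j 1) 1"

definition mpoly_algebra :: "nat \<Rightarrow> ('a::field, 'a mpoly) module"
  where "mpoly_algebra n =
    \<lparr>carrier = {p. \<forall>m\<in>Poly_Mapping.keys p. Poly_Mapping.keys m \<subseteq> {1..n}},
     monoid.mult = (*), one = 1, ring.zero = 0, add = (+),
     module.smult = (\<lambda>c p. Poly_Mapping.single 0 c * p)\<rparr>"

definition trunc_ideal :: "nat \<Rightarrow> nat \<Rightarrow> 'a::field mpoly set"
  where "trunc_ideal q n = genideal (mpoly_algebra n) {mvar j ^ q | j. j \<in> {1..n}}"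

definition trunc_algebra :: "nat \<Rightarrow> nat \<Rightarrow> ('a::field, 'a mpoly set) module"
  where "trunc_algebra q n = quot_algebra (mpoly_algebra n) (trunc_ideal q n)"


section \<open>The algebras \<open>A(q,n,e)\<close> and \<open>A[q,n,z]\<close>\<close>

definition A_gens :: "nat \<Rightarrow> nat \<Rightarrow> nat \<Rightarrow> 'a::field mpoly set set"
  where "A_gens q n e =
    {trunc_ideal q n +>\<^bsub>mpoly_algebra n\<^esub> (\<Prod>j=1..n. mvar j ^ i j) | i :: nat \<Rightarrow> nat.
       [(\<Sum>j=1..n. q ^ (j - 1) * i j) = 0] (mod e)}"

definition A_algebra :: "nat \<Rightarrow> nat \<Rightarrow> nat \<Rightarrow> ('a::field, 'a mpoly set) module"
  where "A_algebra q n e = (trunc_algebra q n)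
    \<lparr>carrier := gen_subalgebra ring_of_type_algebra (trunc_algebra q n) (A_gens q n e)\<rparr>"

text \<open>Only meaningful if \<open>z\<close> divides \<open>q ^ n - 1\<close>, in which case the division is exact.\<close>

definition A_bracket :: "nat \<Rightarrow> nat \<Rightarrow> nat \<Rightarrow> ('a::field, 'a mpoly set) module"
  where "A_bracket q n z = A_algebra q n ((q ^ n - 1) div z)"


section \<open>Prime residues\<close>

definition residue_subgroup :: "nat \<Rightarrow> nat \<Rightarrow> int set set"
  where "residue_subgroup z q =
    generate (units_of (ZFact (int z))) {ZMod (int z) (int q)}"

lemma ZFact_mult: "ZMod m a \<otimes>\<^bsub>ZFact m\<^esub> ZMod m b = ZMod m (a * b)"
proof -
  interpret ideal "Idl\<^bsub>\<Z>\<^esub> {m}" \<Z> by (rule int.genideal_ideal) simp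
  show ?thesis using rcoset_mult_add[of a b] by (simp add: ZFact_def FactRing_def ZMod_def)
qed

lemma ZFact_one_eq: "\<one>\<^bsub>ZFact m\<^esub> = ZMod m 1"
  by (simp add: ZFact_def FactRing_def ZMod_def)

lemma carrier_ZFact: "carrier (ZFact m) = range (ZMod m)"
  by (auto simp: ZFact_def FactRing_def A_RCOSETS_def' ZMod_def)

lemma ZMod_unit:
  assumes "coprime a m"
  shows "ZMod m a \<in> Units (ZFact m)"
proof -
  obtain b where "[a * b = 1] (mod m)" using assms cong_solve_coprime_int by blast
  then have "ZMod m (a * b) = ZMod m 1" by (intro zmod_imp_ZMod) (simp add: cong_def)
  then have "ZMod m a \<otimes>\<^bsub>ZFact m\<^esub> ZMod m b = \<one>\<^bsub>ZFact m\<^esub>" "ZMod m b \<otimes>\<^bsub>ZFact m\<^esub> ZMod m a = \<one>\<^bsub>ZFact m\<^esub>"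
    by (simp_all add: ZFact_mult ZFact_one_eq mult.commute[of b a])
  then show ?thesis
    unfolding Units_def carrier_ZFact by blast
qed

lemma finite_carrier_ZFact:
  assumes "m > 0"
  shows "finite (carrier (ZFact m))"
proof -
  have "ZMod m a \<in> ZMod m ` {0..<m}" for a
    using assms ZMod_mod[of m a] by (intro image_eqI[of _ _ "a mod m"]) simp_all
  then have "carrier (ZFact m) \<subseteq> ZMod m ` {0..<m}"
    unfolding carrier_ZFact by blast
  then show ?thesis by (rule finite_subset) simp
qed

lemma residue_subgroup_finite:
  assumes "z > 0" and "coprime q z"
  shows "subgroup (residue_subgroup z q) (units_of (ZFact (int z)))" and "finite (residue_subgroup z q)"
proof -
  let ?R = "ZFact (int z)"
  interpret R: cring ?R by (rule ZFact_is_cring)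
  interpret U: group "units_of ?R" by (rule R.units_group)
  have "{ZMod (int z) (int q)} \<subseteq> carrier (units_of ?R)"
    using ZMod_unit[of "int q" "int z"] assms by (simp add: units_of_carrier)
  then show *: "subgroup (residue_subgroup z q) (units_of ?R)"
    unfolding residue_subgroup_def by (rule U.generate_is_subgroup)
  have "residue_subgroup z q \<subseteq> carrier ?R"
    using subgroup.subset[OF *] by (auto simp: units_of_carrier Units_def)
  then show "finite (residue_subgroup z q)"
    using finite_carrier_ZFact[of "int z"] assms by (simp add: finite_subset)
qed

lemma dvd_power_card_residue_subgroup:
  assumes "z > 0" and "q > 0" and "coprime q z"
  shows "z dvd q ^ card (residue_subgroup z q) - 1"
proof -
  let ?R = "ZFact (int z)" and ?x = "ZMod (int z) (int q)"
  interpret R: cring ?R by (rule ZFact_is_cring)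
  interpret U: group "units_of ?R" by (rule R.units_group)
  have x: "?x \<in> carrier (units_of ?R)"
    using ZMod_unit[of "int q" "int z"] assms by (simp add: units_of_carrier)
  have pow: "?x [^]\<^bsub>units_of ?R\<^esub> k = ZMod (int z) (int q ^ k)" for k :: nat
    by (induction k) (simp_all add: units_of_one units_of_mult ZFact_one_eq ZFact_mult mult.commute)
  have "?x [^]\<^bsub>units_of ?R\<^esub> card (residue_subgroup z q) = \<one>\<^bsub>units_of ?R\<^esub>"
    unfolding residue_subgroup_def using U.generate_pow_card[OF x] U.pow_ord_eq_1[OF x] by simp
  then have "int q ^ card (residue_subgroup z q) mod int z = 1 mod int z"
    unfolding pow units_of_one ZFact_one_eq by (rule ZMod_imp_zmod)
  then have "int z dvd int q ^ card (residue_subgroup z q) - 1"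
    by (simp add: mod_eq_dvd_iff)
  then have "int z dvd int (q ^ card (residue_subgroup z q) - 1)" using assms by (simp add: of_nat_diff)
  then show ?thesis by (simp only: of_nat_dvd_iff)
qed


section \<open>The algebra axioms for these constructions\<close>

lemma keys_vars_mult:
  fixes p r :: "'a::field mpoly"
  assumes "\<forall>m\<in>Poly_Mapping.keys p. Poly_Mapping.keys m \<subseteq> V" "\<forall>m\<in>Poly_Mapping.keys r. Poly_Mapping.keys m \<subseteq> V"
  shows "\<forall>m\<in>Poly_Mapping.keys (p * r). Poly_Mapping.keys m \<subseteq> V"
proof
  fix m assume "m \<in> Poly_Mapping.keys (p * r)"
  then obtain a b where "a \<in> Poly_Mapping.keys p" "b \<in> Poly_Mapping.keys r" "m = a + b"
    using keys_mult[of p r] by auto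
  then show "Poly_Mapping.keys m \<subseteq> V" using assms Poly_Mapping.keys_add[of a b] by blast
qed

lemma algebra_mpoly: "algebra ring_of_type_algebra (mpoly_algebra n :: ('a::field, 'a mpoly) module)"
proof (rule algebraI)
  show "cring (ring_of_type_algebra :: 'a ring)" by (rule cring_from_type_algebra)
  show "cring (mpoly_algebra n :: ('a::field, 'a mpoly) module)"
  proof (rule cringI)
    show "abelian_group (mpoly_algebra n :: ('a::field, 'a mpoly) module)"
    proof (rule abelian_groupI)
      fix x :: "'a mpoly" assume "x \<in> carrier (mpoly_algebra n)"
      then show "\<exists>y\<in>carrier (mpoly_algebra n). y \<oplus>\<^bsub>mpoly_algebra n\<^esub> x = \<zero>\<^bsub>mpoly_algebra n\<^esub>"
        by (intro bexI[of _ "- x"]) (auto simp: mpoly_algebra_def)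
    qed (use Poly_Mapping.keys_add in \<open>(fastforce simp: mpoly_algebra_def add_ac)+\<close>)
    show "comm_monoid (mpoly_algebra n :: ('a::field, 'a mpoly) module)"
      by (rule comm_monoidI) (auto simp: mpoly_algebra_def mult_ac intro: keys_vars_mult[THEN bspec, THEN subsetD] simp del: One_nat_def)
  qed (auto simp: mpoly_algebra_def distrib_right)
  fix a :: 'a and x :: "'a mpoly" assume "x \<in> carrier (mpoly_algebra n)"
  then show "a \<odot>\<^bsub>mpoly_algebra n\<^esub> x \<in> carrier (mpoly_algebra n)"
    using keys_vars_mult[of "Poly_Mapping.single 0 a" "{1..n}" x] by (auto simp: mpoly_algebra_def)
qed (auto simp: mpoly_algebra_def ring_of_type_algebra_def algebra_simps single_add mult_single
      simp flip: mult.assoc)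

lemma algebra_quot:
  assumes "algebra R M" "ideal I M"
  shows "algebra R (quot_algebra M I)"
proof -
  interpret algebra R M by fact
  interpret I: ideal I M by fact
  let ?Q = "quot_algebra M I"
  interpret Qu: cring "M Quot I" by (rule I.quotient_is_cring) (rule M_cring)
  have sm: "c \<odot>\<^bsub>?Q\<^esub> (I +>\<^bsub>M\<^esub> x) = I +>\<^bsub>M\<^esub> (c \<odot>\<^bsub>M\<^esub> x)" if "c \<in> carrier R" "x \<in> carrier M" for c x
  proof -
    have "I +>\<^bsub>M\<^esub> (c \<odot>\<^bsub>M\<^esub> y) = I +>\<^bsub>M\<^esub> (c \<odot>\<^bsub>M\<^esub> x)" if y: "y \<in> I +>\<^bsub>M\<^esub> x" for y
    proof -
      obtain i where i: "i \<in> I" "y = i \<oplus>\<^bsub>M\<^esub> x" using y by (auto simp: a_r_coset_def')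
      have ic: "i \<in> carrier M" using i I.a_subset by auto
      have "c \<odot>\<^bsub>M\<^esub> i = (c \<odot>\<^bsub>M\<^esub> \<one>\<^bsub>M\<^esub>) \<otimes>\<^bsub>M\<^esub> i" 
        using that ic \<open>c \<in> carrier R\<close> by (simp add: smult_assoc2)
      then have "c \<odot>\<^bsub>M\<^esub> i \<in> I" using I.I_l_closed[OF i(1)] \<open>c \<in> carrier R\<close> by auto
      moreover have "c \<odot>\<^bsub>M\<^esub> y = c \<odot>\<^bsub>M\<^esub> i \<oplus>\<^bsub>M\<^esub> c \<odot>\<^bsub>M\<^esub> x"
        using i ic \<open>c \<in> carrier R\<close> \<open>x \<in> carrier M\<close> by (simp add: smult_r_distr)
      ultimately have "c \<odot>\<^bsub>M\<^esub> y \<in> I +>\<^bsub>M\<^esub> (c \<odot>\<^bsub>M\<^esub> x)" by (auto simp: a_r_coset_def')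
      then show ?thesis using I.a_repr_independence' \<open>c \<in> carrier R\<close> \<open>x \<in> carrier M\<close>
        by (metis smult_closed)
    qed
    moreover have "x \<in> I +>\<^bsub>M\<^esub> x" using I.a_rcos_self that by blast
    ultimately have "(\<Union>y\<in>I +>\<^bsub>M\<^esub> x. I +>\<^bsub>M\<^esub> (c \<odot>\<^bsub>M\<^esub> y)) = I +>\<^bsub>M\<^esub> (c \<odot>\<^bsub>M\<^esub> x)"
      by blast
    then show ?thesis by (simp add: quot_algebra_def)
  qed
  have car: "carrier ?Q = {I +>\<^bsub>M\<^esub> x |x. x \<in> carrier M}"
    by (auto simp: quot_algebra_def FactRing_def A_RCOSETS_def')
  have ops: "add ?Q = add (M Quot I)" "monoid.mult ?Q = monoid.mult (M Quot I)"
    by (simp_all add: quot_algebra_def)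
  have add: "(I +>\<^bsub>M\<^esub> x) \<oplus>\<^bsub>?Q\<^esub> (I +>\<^bsub>M\<^esub> y) = I +>\<^bsub>M\<^esub> (x \<oplus>\<^bsub>M\<^esub> y)" if "x \<in> carrier M" "y \<in> carrier M" for x y
    using that by (simp add: ops FactRing_def I.a_rcos_sum)
  have mul: "(I +>\<^bsub>M\<^esub> x) \<otimes>\<^bsub>?Q\<^esub> (I +>\<^bsub>M\<^esub> y) = I +>\<^bsub>M\<^esub> (x \<otimes>\<^bsub>M\<^esub> y)" if "x \<in> carrier M" "y \<in> carrier M" for x y
    using that by (simp add: ops FactRing_def I.rcoset_mult_add)
  have "cring ?Q"
  proof (rule cringI)
    show "abelian_group ?Q"
    proof (rule abelian_groupI)
      fix x assume "x \<in> carrier ?Q"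
      then show "\<exists>y\<in>carrier ?Q. y \<oplus>\<^bsub>?Q\<^esub> x = \<zero>\<^bsub>?Q\<^esub>"
        by (intro bexI[of _ "\<ominus>\<^bsub>M Quot I\<^esub> x"]) (simp_all add: quot_algebra_def Qu.l_neg)
    qed (simp_all add: quot_algebra_def Qu.a_ac)
    show "comm_monoid ?Q"
      by (rule comm_monoidI) (simp_all add: quot_algebra_def Qu.m_ac)
  qed (simp_all add: quot_algebra_def Qu.l_distr)
  then show ?thesis
    by (intro algebraI R_cring) (auto simp: car sm add mul smult_l_distr smult_r_distr smult_assoc1 smult_assoc2)
qed

lemma trunc_ideal: "ideal (trunc_ideal q n :: 'a::field mpoly set) (mpoly_algebra n)"
proof -
  interpret algebra ring_of_type_algebra "mpoly_algebra n :: ('a::field, 'a mpoly) module"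
    by (rule algebra_mpoly)
  have "mvar j ^ q \<in> carrier (mpoly_algebra n :: ('a::field, 'a mpoly) module)" if "j \<in> {1..n}" for j
  proof (induction q)
    case 0
    show ?case using one_closed by (simp add: mpoly_algebra_def)
  next
    case (Suc k)
    have "mvar j \<in> carrier (mpoly_algebra n :: ('a::field, 'a mpoly) module)" 
      using that by (auto simp: mvar_def mpoly_algebra_def)
    from m_closed[OF this Suc] show ?case by (simp add: mpoly_algebra_def)
  qed
  then show ?thesis unfolding trunc_ideal_def by (intro genideal_ideal) auto
qed

lemma algebra_gen_subalgebra:
  assumes "algebra R M" "S \<subseteq> carrier M"
  shows "algebra R (M\<lparr>carrier := gen_subalgebra R M S\<rparr>)"
proof -
  interpret algebra R M by fact
  let ?F = "{B. submodule B R M \<and> subring B M \<and> S \<subseteq> B}"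
  let ?G = "gen_subalgebra R M S"
  have car: "carrier M \<in> ?F"
    using assms(2) carrier_is_submodule carrier_is_subring by auto
  have "subring ?G M"
  proof (rule subringI)
    show "?G \<subseteq> carrier M" using car unfolding gen_subalgebra_def by blast
  qed (auto simp: gen_subalgebra_def subringE)
  then have "subcring ?G M" by (rule subcringI') 
  then have "cring (M\<lparr>carrier := ?G\<rparr>)" using subcring_iff subcringE(1) subcring_iff by blast
  moreover have "c \<odot>\<^bsub>M\<^esub> x \<in> ?G" if "c \<in> carrier R" "x \<in> ?G" for c x
    using that submodule.smult_closed unfolding gen_subalgebra_def by fastforce
  moreover have "x \<in> carrier M" if "x \<in> ?G" for x
    using that car unfolding gen_subalgebra_def by blast
  ultimately show ?thesis
    by (intro algebraI R_cring) (auto simp: smult_l_distr smult_r_distr smult_assoc1 smult_assoc2)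
qed

lemma algebra_trunc: "algebra ring_of_type_algebra (trunc_algebra q n :: ('a::field, 'a mpoly set) module)"
  unfolding trunc_algebra_def by (intro algebra_quot algebra_mpoly trunc_ideal)

lemma algebra_A: "algebra ring_of_type_algebra (A_algebra q n e :: ('a::field, 'a mpoly set) module)"
proof -
  let ?M = "mpoly_algebra n :: ('a::field, 'a mpoly) module"
  interpret algebra ring_of_type_algebra ?M by (rule algebra_mpoly)
  have *: "monoid.mult ?M = (*)" "one ?M = 1" by (simp_all add: mpoly_algebra_def)
  have pw: "x ^ k \<in> carrier ?M" if "x \<in> carrier ?M" for x :: "'a mpoly" and k :: nat
    by (induction k) (use that m_closed one_closed in \<open>simp_all add: *\<close>)
  have v: "mvar j \<in> carrier ?M" if "j \<in> {1..n}" for j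
    using that by (auto simp: mvar_def mpoly_algebra_def)
  have pr: "(\<Prod>j\<in>J. mvar j ^ i j) \<in> carrier ?M" if "finite J" "J \<subseteq> {1..n}" for J and i :: "nat \<Rightarrow> nat"
    using that by (induction J rule: finite_induct) (use m_closed one_closed pw v in \<open>simp_all add: *\<close>)
  then have "A_gens q n e \<subseteq> carrier (trunc_algebra q n :: ('a, 'a mpoly set) module)"
    by (auto simp: A_gens_def trunc_algebra_def quot_algebra_def FactRing_def A_RCOSETS_def')
  then show ?thesis unfolding A_algebra_def by (intro algebra_gen_subalgebra algebra_trunc)
qed

end

theory Submission
  imports Defs
begin

text \<open>Put \<open>e = (q ^ n - 1) / z\<close>. Writing a number in base \<open>q\<close> identifies the nonzero monomials of
  \<open>A[q,n,z]\<close> with the multiples \<open>k * e\<close> for \<open>k = 0, \<dots>, z\<close>; they form a basis \<open>b\<^sub>0, \<dots>, b\<^sub>z\<close>, and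
  \<open>b\<^sub>k b\<^sub>l\<close> is \<open>b\<^sub>k\<^sub>+\<^sub>l\<close> if the addition of \<open>k * e\<close> and \<open>l * e\<close> has no carry, and \<open>0\<close> otherwise. A carry
  out of some position becomes an overflow of the whole \<open>n\<close>-digit number after a cyclic shift of the
  digits, and cyclic shifts multiply \<open>k\<close> and \<open>l\<close> by powers of \<open>q\<close> modulo \<open>z\<close>. Hence the multiplication
  table depends only on the subgroup generated by \<open>q\<close>.\<close>

section \<open>Digits and carries\<close>

definition exponents :: "nat \<Rightarrow> (nat \<Rightarrow> nat) \<Rightarrow> nat \<Rightarrow>\<^sub>0 nat"
  where "exponents n d = (\<Sum>j=1..n. Poly_Mapping.single j (d j))"

text \<open>The exponents are read as base \<open>q\<close> digits, that of the first variable being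
  the units digit. Digits of size \<open>q\<close> or more are allowed, which makes the weight
  additive on products of monomials.\<close>

definition weight :: "nat \<Rightarrow> nat \<Rightarrow> (nat \<Rightarrow>\<^sub>0 nat) \<Rightarrow> nat"
  where "weight q n m = (\<Sum>j=1..n. q ^ (j - 1) * Poly_Mapping.lookup m j)"

text \<open>These are the exponent vectors of the monomials that survive modulo all
  \<open>X_j ^ q\<close>.\<close>

definition reduced :: "nat \<Rightarrow> nat \<Rightarrow> (nat \<Rightarrow>\<^sub>0 nat) \<Rightarrow> bool"
  where "reduced q n m \<longleftrightarrow> Poly_Mapping.keys m \<subseteq> {1..n} \<and> (\<forall>j\<in>{1..n}. Poly_Mapping.lookup m j < q)"

definition digits :: "nat \<Rightarrow> nat \<Rightarrow> nat \<Rightarrow> nat \<Rightarrow>\<^sub>0 nat"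
  where "digits q n N = exponents n (\<lambda>j. N div q ^ (j - 1) mod q)"

lemma lookup_exponents: "Poly_Mapping.lookup (exponents n d) j = (if j \<in> {1..n} then d j else 0)"
  by (simp add: exponents_def lookup_sum lookup_single when_def sum.delta')

lemma keys_exponents: "Poly_Mapping.keys (exponents n d) \<subseteq> {1..n}"
proof
  fix j assume "j \<in> Poly_Mapping.keys (exponents n d)"
  then have "Poly_Mapping.lookup (exponents n d) j \<noteq> 0" by (simp add: in_keys_iff)
  then show "j \<in> {1..n}" unfolding lookup_exponents by (auto split: if_splits)
qed

lemma exponents_lookup:
  assumes "Poly_Mapping.keys m \<subseteq> {1..n}"
  shows "exponents n (Poly_Mapping.lookup m) = m"
  using assms by (intro poly_mapping_eqI) (auto simp: lookup_exponents in_keys_iff subset_iff)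

lemma weight_exponents: "weight q n (exponents n d) = (\<Sum>j=1..n. q ^ (j - 1) * d j)"
  by (simp add: weight_def lookup_exponents)

lemma weight_add: "weight q n (a + b) = weight q n a + weight q n b"
  by (simp add: weight_def lookup_add sum.distrib algebra_simps)

lemma reduced_digits: "q > 0 \<Longrightarrow> reduced q n (digits q n N)"
  using keys_exponents by (simp add: reduced_def digits_def lookup_exponents)

lemma reduced_addD:
  assumes "reduced q n (a + b)"
  shows "reduced q n a"
proof -
  have "Poly_Mapping.keys a \<subseteq> Poly_Mapping.keys (a + b)" by (auto simp: in_keys_iff lookup_add)
  then show ?thesis using assms by (fastforce simp: reduced_def lookup_add)
qed

lemma sum_digits: "(\<Sum>j=1..n. q ^ (j - 1) * (N div q ^ (j - 1) mod q)) = (N::nat) mod q ^ n"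
proof (induction n)
  case (Suc n)
  have "(\<Sum>j=1..Suc n. q ^ (j - 1) * (N div q ^ (j - 1) mod q)) = N mod q ^ n + q ^ n * (N div q ^ n mod q)"
    using Suc by simp
  also have "\<dots> = N mod (q ^ n * q)" by (simp only: mod_mult2_eq add.commute)
  finally show ?case by (simp add: mult.commute)
qed simp

lemma sum_digits_less:
  fixes q :: nat
  assumes "\<forall>j\<in>{1..n}. d j < q"
  shows "(\<Sum>j=1..n. q ^ (j - 1) * d j) < q ^ n"
  using assms
proof (induction n)
  case (Suc n)
  have "d (Suc n) + 1 \<le> q" using Suc.prems by (simp add: Suc_leI)
  then have "q ^ n * (d (Suc n) + 1) \<le> q ^ n * q" by (rule mult_le_mono2)
  moreover have "(\<Sum>j=1..n. q ^ (j - 1) * d j) < q ^ n" using Suc by simp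
  ultimately show ?case by (simp add: mult.commute)
qed simp

lemma digit_sum:
  fixes q :: nat
  assumes "\<forall>j\<in>{1..n}. d j < q" and "j \<in> {1..n}"
  shows "(\<Sum>j=1..n. q ^ (j - 1) * d j) div q ^ (j - 1) mod q = d j"
  using assms
proof (induction n)
  case (Suc n)
  let ?S = "\<Sum>j=1..n. q ^ (j - 1) * d j"
  have less: "?S < q ^ n" using Suc.prems(1) by (intro sum_digits_less) simp
  have q: "q > 0" using Suc.prems by fastforce
  show ?case
  proof (cases "j = Suc n")
    case True
    then show ?thesis using less q Suc.prems(1) by simp
  next
    case False
    then have j: "j \<in> {1..n}" using Suc.prems(2) by auto
    \<comment> \<open>After division by \<open>q ^ (j - 1)\<close> the top digit still carries a
      factor \<open>q\<close>, so it does not affect the digit at position \<open>j\<close>.\<close>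
    define r where "r = n - j"
    have "q ^ n = q ^ (j - 1) * (q * q ^ r)"
      using j by (simp add: r_def flip: power_Suc power_add)
    then have "(?S + q ^ n * d (Suc n)) div q ^ (j - 1) = ?S div q ^ (j - 1) + q * (q ^ r * d (Suc n))"
      using q by (simp add: mult.assoc)
    then show ?thesis using Suc.IH[OF _ j] Suc.prems(1) by simp
  qed
qed simp

lemma weight_digits: "weight q n (digits q n N) = N mod q ^ n"
  unfolding digits_def weight_exponents by (rule sum_digits)

text \<open>Uniqueness of base \<open>q\<close> digits: a reduced monomial can be recovered from its
  weight.\<close>

lemma digits_weight:
  assumes "reduced q n m"
  shows "digits q n (weight q n m) = m"
proof (rule poly_mapping_eqI)
  fix j
  show "Poly_Mapping.lookup (digits q n (weight q n m)) j = Poly_Mapping.lookup m j"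
    using assms digit_sum[of n "Poly_Mapping.lookup m" q j]
    by (auto simp: digits_def lookup_exponents weight_def reduced_def in_keys_iff subset_iff)
qed

lemma weight_less: "reduced q n m \<Longrightarrow> weight q n m < q ^ n"
  unfolding weight_def reduced_def by (intro sum_digits_less) simp

section \<open>Carries and cyclic shifts of digits\<close>

lemma reduced_add_digits_iff:
  "reduced q n (digits q n M + digits q n N) \<longleftrightarrow>
     (\<forall>j<n. M div q ^ j mod q + N div q ^ j mod q < q)"
proof -
  have "Poly_Mapping.keys (digits q n M + digits q n N) \<subseteq> {1..n}"
    using Poly_Mapping.keys_add[of "digits q n M" "digits q n N"] keys_exponents by (fastforce simp: digits_def)
  then have "reduced q n (digits q n M + digits q n N) \<longleftrightarrow>
     (\<forall>j\<in>{1..n}. M div q ^ (j - 1) mod q + N div q ^ (j - 1) mod q < q)"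
    by (simp add: reduced_def lookup_add digits_def lookup_exponents)
  also have "\<dots> \<longleftrightarrow> (\<forall>j\<in>Suc ` {..<n}. M div q ^ (j - 1) mod q + N div q ^ (j - 1) mod q < q)"
    by (simp only: image_Suc_lessThan)
  also have "\<dots> \<longleftrightarrow> (\<forall>j<n. M div q ^ j mod q + N div q ^ j mod q < q)"
    unfolding ball_simps by auto
  finally show ?thesis .
qed

text \<open>If no digit pair overflows, induction on \<open>m\<close> shows that the lowest
  \<open>m\<close> digits do not overflow either; conversely, dropping the lower part from the
  inequality for \<open>m = j + 1\<close> bounds the digit pair at \<open>j\<close>. Cyclic shifts
  act well on the right-hand form.\<close>

lemma no_carry_iff:
  fixes q M N :: nat
  assumes "q > 0"
  shows "(\<forall>j<n. M div q ^ j mod q + N div q ^ j mod q < q) \<longleftrightarrow>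
         (\<forall>m\<in>{1..n}. M mod q ^ m + N mod q ^ m < q ^ m)"
proof -
  have rec: "A mod q ^ Suc j = q ^ j * (A div q ^ j mod q) + A mod q ^ j" for A j
    by (simp only: power_Suc2 mod_mult2_eq)
  show ?thesis
  proof (intro iffI ballI allI impI)
    fix m assume *: "\<forall>j<n. M div q ^ j mod q + N div q ^ j mod q < q" and "m \<in> {1..n}"
    then have "m \<le> n" by simp
    then show "M mod q ^ m + N mod q ^ m < q ^ m"
    proof (induction m)
      case (Suc m)
      have "M div q ^ m mod q + N div q ^ m mod q + 1 \<le> q" using * Suc.prems by (simp add: Suc_leI)
      then have "q ^ m * (M div q ^ m mod q + N div q ^ m mod q + 1) \<le> q ^ m * q"
        by (rule mult_le_mono2)
      then show ?case unfolding rec using Suc by (simp add: algebra_simps)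
    qed simp
  next
    fix j assume *: "\<forall>m\<in>{1..n}. M mod q ^ m + N mod q ^ m < q ^ m" and "j < n"
    then have "q ^ j * (M div q ^ j mod q + N div q ^ j mod q) < q ^ j * q"
      using *[rule_format, of "Suc j"] unfolding rec by (simp add: algebra_simps)
    then show "M div q ^ j mod q + N div q ^ j mod q < q" by simp
  qed
qed

text \<open>The representative of \<open>h * k\<close> modulo \<open>z\<close> is taken in \<open>{1..z}\<close> for \<open>k > 0\<close>: the digits of
  \<open>z * e = q ^ n - 1\<close> are all \<open>q - 1\<close>, so that \<open>k = z\<close> must not be identified with \<open>k = 0\<close>.\<close>

definition residue_rep :: "nat \<Rightarrow> nat \<Rightarrow> nat \<Rightarrow> nat"
  where "residue_rep z h k = (if k = 0 then 0 else if z dvd h * k then z else h * k mod z)"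

lemma residue_rep_cong: "[h = h'] (mod z) \<Longrightarrow> residue_rep z h k = residue_rep z h' k"
  using cong_scalar_right[of h h' z k] by (auto simp: residue_rep_def cong_def dvd_eq_mod_eq_0)

text \<open>The last hypothesis settles the only ambiguity of a representative in
  \<open>{0..z}\<close>, that between \<open>0\<close> and \<open>z\<close>.\<close>

lemma residue_rep_eqI:
  assumes "[k' = h * k] (mod z)" "k' \<le> z" "k' = 0 \<longleftrightarrow> k = 0"
  shows "residue_rep z h k = k'"
proof (cases "k' = z \<or> k = 0")
  case True
  then show ?thesis using assms by (auto simp: residue_rep_def cong_def dvd_eq_mod_eq_0)
next
  case False
  then have "k' < z" "k' \<noteq> 0" using assms by auto
  then have "h * k mod z = k'" using assms(1) by (simp add: cong_def)
  then show ?thesis using False \<open>k' \<noteq> 0\<close> by (auto simp: residue_rep_def)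
qed

definition compatible :: "nat \<Rightarrow> nat \<Rightarrow> nat \<Rightarrow> nat \<Rightarrow> bool"
  where "compatible q z k l \<longleftrightarrow> (\<forall>j. residue_rep z (q ^ j) k + residue_rep z (q ^ j) l \<le> z)"

text \<open>The left-hand side is the number obtained from the \<open>n\<close>-digit number \<open>k * e\<close> by a cyclic shift
  that moves its last \<open>m\<close> digits to the front.\<close>

lemma digit_rotation:
  fixes q n z e k m :: nat
  assumes "q > 1" "e * z = q ^ n - 1" "e > 0" "k \<le> z" "m \<le> n"
  shows "q ^ (n - m) * (k * e mod q ^ m) + k * e div q ^ m = e * residue_rep z (q ^ (n - m)) k"
proof -
  let ?a = "k * e" and ?p = "q ^ (n - m)"
  let ?r = "?p * (?a mod q ^ m) + ?a div q ^ m"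
  have pn: "q ^ n = ?p * q ^ m" using assms(5) by (simp flip: power_add)
  have qn: "q ^ n > 0" and qm: "q ^ m > 0" using assms(1) by auto
  have "?a \<le> z * e" using assms(4) by simp
  then have a: "?a < q ^ n" using assms(2) qn by (metis mult.commute le_imp_less_Suc Suc_pred' One_nat_def)
  \<comment> \<open>A shift by \<open>n - m\<close> places is multiplication by
    \<open>q ^ (n - m)\<close>. Since \<open>q ^ n = e * z + 1\<close>, bringing the overflowing
    digits round to the units end changes the value only by a multiple of
    \<open>e * z\<close>.\<close>
  have key: "?r + e * z * (?a div q ^ m) = ?p * ?a"
  proof -
    have "?p * ?a = ?p * (q ^ m * (?a div q ^ m) + ?a mod q ^ m)" by (simp only: mult_div_mod_eq)
    also have "\<dots> = q ^ n * (?a div q ^ m) + ?p * (?a mod q ^ m)"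
      by (simp only: pn distrib_left mult.assoc)
    also have "q ^ n = e * z + 1" using assms(2) qn by simp
    finally show ?thesis by (simp add: algebra_simps)
  qed
  have "e dvd ?r"
  proof -
    have "e dvd ?r + e * z * (?a div q ^ m)" unfolding key by simp
    then show ?thesis by (metis dvd_add_left_iff dvd_triv_left mult.assoc)
  qed
  then obtain k' where k': "?r = e * k'" by (rule dvdE)
  have "e * (k' + z * (?a div q ^ m)) = e * (?p * k)" using key unfolding k' by (simp add: algebra_simps)
  then have eq: "k' + z * (?a div q ^ m) = ?p * k" using assms(3) by simp
  \<comment> \<open>The shifted number again has at most \<open>n\<close> digits, so it is at most
    \<open>q ^ n - 1 = e * z\<close>; hence its quotient by \<open>e\<close> is at most
    \<open>z\<close>.\<close>
  have "?a div q ^ m < ?p" using a by (simp add: pn less_mult_imp_div_less)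
  moreover have "?p * (?a mod q ^ m + 1) \<le> ?p * q ^ m"
    using qm by (intro mult_le_mono2) (simp add: Suc_leI)
  ultimately have "?r < q ^ n" unfolding pn by (simp add: algebra_simps)
  then have "e * k' \<le> e * z" using k' assms(2) by simp
  then have le: "k' \<le> z" using assms(3) by simp
  \<comment> \<open>A shifted number vanishes only if the original does, which tells the
    representatives \<open>0\<close> and \<open>z\<close> apart.\<close>
  have "k' = 0 \<longleftrightarrow> ?r = 0" using k' assms(3) by simp
  also have "\<dots> \<longleftrightarrow> ?a mod q ^ m = 0 \<and> ?a div q ^ m = 0" using assms(1) by auto
  also have "\<dots> \<longleftrightarrow> ?a = 0" by (metis div_0 mod_0 div_mult_mod_eq mult_0 add_0)
  finally have zero: "k' = 0 \<longleftrightarrow> k = 0" using assms(3) by simp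
  have "[k' = ?p * k] (mod z)" unfolding eq[symmetric] by (simp add: cong_def)
  then have "residue_rep z ?p k = k'" using le zero by (rule residue_rep_eqI)
  then show ?thesis using k' by simp
qed

text \<open>A cyclic shift puts the last \<open>m\<close> digits on top, so a carry out of them
  makes the shifted numbers add up to at least \<open>q ^ n = e * z + 1\<close>. After division by
  \<open>e\<close> this says that the two representatives add up to more than
  \<open>z\<close>.\<close>

lemma no_carry_iff_compatible:
  fixes q n z e k l :: nat
  assumes "q > 1" "e * z = q ^ n - 1" "e > 0" "n > 0" "k \<le> z" "l \<le> z"
  shows "(\<forall>m\<in>{1..n}. k * e mod q ^ m + l * e mod q ^ m < q ^ m) \<longleftrightarrow> compatible q z k l"
proof
  let ?rk = "\<lambda>m. residue_rep z (q ^ (n - m)) k" and ?rl = "\<lambda>m. residue_rep z (q ^ (n - m)) l"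
  have qn: "q ^ n = e * z + 1" and qm: "\<And>m. q ^ m > 0" using assms(1,2) by auto
  have rot: "e * (?rk m + ?rl m) =
      q ^ (n - m) * (k * e mod q ^ m + l * e mod q ^ m) + (k * e div q ^ m + l * e div q ^ m)" if "m \<le> n" for m
    using digit_rotation[OF assms(1-3,5) that] digit_rotation[OF assms(1-3,6) that]
    by (simp add: algebra_simps)
  {
    assume *: "\<forall>m\<in>{1..n}. k * e mod q ^ m + l * e mod q ^ m < q ^ m"
    show "compatible q z k l" unfolding compatible_def
    proof
      fix j
      \<comment> \<open>Powers of \<open>q\<close> modulo \<open>z\<close> repeat with period
        \<open>n\<close>, so \<open>j\<close> may be replaced by \<open>j mod n\<close>. Residue
        \<open>0\<close> gives \<open>m = n\<close>, the trivial shift.\<close>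
      define m where "m = n - j mod n"
      have m: "m \<in> {1..n}" "n - m = j mod n" using assms(4) by (auto simp: m_def Suc_leI)
      let ?p = "q ^ (n - m)" and ?L = "k * e mod q ^ m + l * e mod q ^ m"
      have pn: "q ^ n = ?p * q ^ m" using m(1) by (simp flip: power_add)
      have "k * e \<le> z * e" "l * e \<le> z * e" using assms(5,6) by simp_all
      then have "k * e < q ^ n" "l * e < q ^ n" unfolding qn by (simp_all add: mult.commute le_imp_less_Suc del: mult_le_cancel1 mult_le_cancel2)
      \<comment> \<open>The hypothesis at \<open>m = n\<close> is needed besides the one at
        \<open>m\<close>: it keeps the former leading digits, which form the low part after the
        shift, from carrying into the moved digits.\<close>
      then have "k * e + l * e < q ^ n" using *[rule_format, of n] assms(4) by simp
      then have T: "(k * e + l * e) div q ^ m < ?p" unfolding pn by (simp add: less_mult_imp_div_less)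
      have "k * e div q ^ m + l * e div q ^ m \<le> (k * e + l * e) div q ^ m"
        by (metis div_add1_eq le_add1)
      moreover have "?p * (?L + 1) \<le> ?p * q ^ m" using * m(1) by (intro mult_le_mono2) (simp add: Suc_leI)
      moreover have "A * L + S < A * B" if "S \<le> U" "A * (L + 1) \<le> A * B" "U < A" for A B L S U :: nat
        using that by simp
      ultimately have "?p * ?L + (k * e div q ^ m + l * e div q ^ m) < ?p * q ^ m"
        using T by metis
      moreover have "m \<le> n" using m(1) by simp
      ultimately have "e * (?rk m + ?rl m) < q ^ n"
        by (simp only: rot pn)
      then have "e * (?rk m + ?rl m) \<le> e * z" unfolding qn by linarith
      then have "?rk m + ?rl m \<le> z" using assms(3) by simp
      moreover have "[q ^ (n - m) = q ^ j] (mod z)"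
      proof -
        have "[q ^ n = 1] (mod z)" unfolding qn by (simp only: cong_def mod_mult_self3)
        then have "[(q ^ n) ^ (j div n) * q ^ (j mod n) = 1 ^ (j div n) * q ^ (j mod n)] (mod z)"
          by (intro cong_mult cong_pow) simp_all
        moreover have "(q ^ n) ^ (j div n) * q ^ (j mod n) = q ^ j"
          by (simp flip: power_mult power_add)
        ultimately show ?thesis by (simp add: m(2) cong_sym_eq)
      qed
      ultimately show "residue_rep z (q ^ j) k + residue_rep z (q ^ j) l \<le> z"
        using residue_rep_cong by metis
    qed
  next
    assume *: "compatible q z k l"
    show "\<forall>m\<in>{1..n}. k * e mod q ^ m + l * e mod q ^ m < q ^ m"
    proof (rule ballI, rule ccontr)
      fix m assume m: "m \<in> {1..n}" and "\<not> k * e mod q ^ m + l * e mod q ^ m < q ^ m"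
      then have "q ^ (n - m) * q ^ m \<le> q ^ (n - m) * (k * e mod q ^ m + l * e mod q ^ m)"
        by (intro mult_le_mono2) simp
      then have "q ^ n \<le> e * (?rk m + ?rl m)" using rot[of m] m by (simp flip: power_add)
      also have "\<dots> \<le> e * z" using * by (intro mult_le_mono2) (simp add: compatible_def)
      finally show False unfolding qn by simp
    qed
  }
qed

section \<open>Dependence on the subgroup of prime residues\<close>

lemma residue_subgroup_eq:
  assumes "z > 0" and "coprime q z"
  shows "residue_subgroup z q = range (\<lambda>k. ZMod (int z) (int q ^ k))"
proof -
  let ?R = "ZFact (int z)" and ?x = "ZMod (int z) (int q)"
  interpret R: cring ?R by (rule ZFact_is_cring)
  interpret U: group "units_of ?R" by (rule R.units_group)
  have x: "?x \<in> carrier (units_of ?R)"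
    using ZMod_unit[of "int q" "int z"] assms by (simp add: units_of_carrier)
  have pow: "?x [^]\<^bsub>units_of ?R\<^esub> k = ZMod (int z) (int q ^ k)" for k :: nat
    by (induction k) (simp_all add: units_of_one units_of_mult ZFact_one_eq ZFact_mult mult.commute)
  \<comment> \<open>By finiteness of the unit group, the generated subgroup consists of nonnegative
    powers, matching the exponents in \<open>compatible\<close>.\<close>
  have "finite (carrier (units_of ?R))"
    using finite_carrier_ZFact[of "int z"] assms(1)
    by (auto simp: units_of_carrier Units_def intro: finite_subset)
  from U.generate_pow_on_finite_carrier[OF this x]
  have "generate (units_of ?R) {?x} = {?x [^]\<^bsub>units_of ?R\<^esub> k |k. k \<in> (UNIV :: nat set)}" .
  then show ?thesis unfolding residue_subgroup_def pow by auto
qed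

text \<open>Every power of \<open>q\<close> is congruent modulo \<open>z\<close> to a power of
  \<open>Q\<close>, so each inequality required for \<open>q\<close> is among those known for
  \<open>Q\<close>.\<close>

lemma compatible_mono:
  assumes "z > 0" "coprime q z" "coprime Q z" "residue_subgroup z q \<subseteq> residue_subgroup z Q"
    and "compatible Q z k l"
  shows "compatible q z k l"
  unfolding compatible_def
proof
  fix j
  have "ZMod (int z) (int q ^ j) \<in> range (\<lambda>k. ZMod (int z) (int Q ^ k))"
    using assms(4) by (simp add: residue_subgroup_eq assms subset_iff)
  then obtain i where "ZMod (int z) (int q ^ j) = ZMod (int z) (int Q ^ i)" by blast
  then have "int q ^ j mod int z = int Q ^ i mod int z" by (rule ZMod_imp_zmod)
  then have "[int (q ^ j) = int (Q ^ i)] (mod int z)" by (simp add: cong_def)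
  then have "[q ^ j = Q ^ i] (mod z)" by (simp only: cong_int_iff)
  then show "residue_rep z (q ^ j) k + residue_rep z (q ^ j) l \<le> z"
    using assms(5) by (simp add: compatible_def residue_rep_cong[of "q ^ j" "Q ^ i"])
qed


section \<open>Residue classes of polynomials\<close>

lemma poly_mapping_sum_single:
  "(\<Sum>m\<in>Poly_Mapping.keys p. Poly_Mapping.single m (Poly_Mapping.lookup p m)) = p"
  by (intro poly_mapping_eqI)
    (simp add: lookup_sum lookup_single when_def sum.delta' in_keys_iff)

lemma lookup_times_eq_sum:
  fixes p r :: "'a::field mpoly"
  shows "Poly_Mapping.lookup (p * r) m =
    (\<Sum>(a, b)\<in>Poly_Mapping.keys p \<times> Poly_Mapping.keys r.
       if a + b = m then Poly_Mapping.lookup p a * Poly_Mapping.lookup r b else 0)"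
proof -
  have "p * r = (\<Sum>a\<in>Poly_Mapping.keys p. \<Sum>b\<in>Poly_Mapping.keys r.
      Poly_Mapping.single (a + b) (Poly_Mapping.lookup p a * Poly_Mapping.lookup r b))"
    using sum_product[of "\<lambda>a. Poly_Mapping.single a (Poly_Mapping.lookup p a)" "Poly_Mapping.keys p"
        "\<lambda>b. Poly_Mapping.single b (Poly_Mapping.lookup r b)" "Poly_Mapping.keys r"]
    by (simp add: poly_mapping_sum_single mult_single)
  then show ?thesis
    by (simp add: lookup_sum lookup_single when_def sum.cartesian_product case_prod_unfold)
qed

lemma mpoly_algebra_simps:
  "carrier (mpoly_algebra n) = {p. \<forall>m\<in>Poly_Mapping.keys p. Poly_Mapping.keys m \<subseteq> {1..n}}"
  "x \<otimes>\<^bsub>mpoly_algebra n\<^esub> y = x * y" "x \<oplus>\<^bsub>mpoly_algebra n\<^esub> y = x + y"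
  "\<one>\<^bsub>mpoly_algebra n\<^esub> = 1" "\<zero>\<^bsub>mpoly_algebra n\<^esub> = 0"
  "c \<odot>\<^bsub>mpoly_algebra n\<^esub> x = Poly_Mapping.single 0 c * x"
  by (simp_all add: mpoly_algebra_def)

lemma mvar_power: "mvar j ^ k = Poly_Mapping.single (Poly_Mapping.single j k) 1"
  by (induction k) (simp_all add: mvar_def mult_single flip: single_add)

lemma prod_mvar_power:
  "(\<Prod>j=1..n. mvar j ^ i j) = Poly_Mapping.single (exponents n i) (1::'a::field)"
proof -
  have "(\<Prod>j\<in>J. mvar j ^ i j) = Poly_Mapping.single (\<Sum>j\<in>J. Poly_Mapping.single j (i j)) (1::'a)"
    if "finite J" for J
    using that by (induction J rule: finite_induct) (simp_all add: mvar_power mult_single)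
  from this[of "{1..n}"] show ?thesis unfolding exponents_def by simp
qed

section \<open>The truncation ideal as a monomial ideal\<close>

lemma trunc_ideal_subset: "trunc_ideal q n \<subseteq> carrier (mpoly_algebra n)"
  by (rule ideal.Icarr[OF trunc_ideal, THEN subsetI])

lemma trunc_ideal_add: "p \<in> trunc_ideal q n \<Longrightarrow> r \<in> trunc_ideal q n \<Longrightarrow> p + r \<in> trunc_ideal q n"
  using additive_subgroup.a_closed[OF ideal.axioms(1)[OF trunc_ideal]] by (simp add: mpoly_algebra_simps)

lemma trunc_ideal_zero: "0 \<in> trunc_ideal q n"
  using additive_subgroup.zero_closed[OF ideal.axioms(1)[OF trunc_ideal]] by (simp add: mpoly_algebra_simps)

lemma trunc_ideal_mult:
  "p \<in> trunc_ideal q n \<Longrightarrow> r \<in> carrier (mpoly_algebra n) \<Longrightarrow> r * p \<in> trunc_ideal q n"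
  using ideal.I_l_closed[OF trunc_ideal] by (simp add: mpoly_algebra_simps)

lemma constant_in_carrier: "Poly_Mapping.single 0 c \<in> carrier (mpoly_algebra n)"
  by (simp add: mpoly_algebra_simps)

lemma trunc_ideal_uminus:
  fixes p :: "'a::field mpoly"
  assumes "p \<in> trunc_ideal q n"
  shows "- p \<in> trunc_ideal q n"
proof -
  have "Poly_Mapping.single 0 (- 1) * p = - p"
    by (metis mult_1 mult_minus_left single_one single_uminus)
  then show ?thesis using trunc_ideal_mult[OF assms constant_in_carrier] by metis
qed

lemma uminus_mpoly_algebra:
  fixes p :: "'a::field mpoly"
  assumes "p \<in> carrier (mpoly_algebra n)"
  shows "inv\<^bsub>add_monoid (mpoly_algebra n)\<^esub> p = - p"
proof -
  interpret M: algebra ring_of_type_algebra "mpoly_algebra n :: ('a, 'a mpoly) module"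
    by (rule algebra_mpoly)
  have "\<ominus>\<^bsub>mpoly_algebra n\<^esub> p = - p"
    using assms by (intro M.minus_equality) (simp_all add: mpoly_algebra_simps)
  then show ?thesis by (simp add: a_inv_def)
qed

text \<open>Multiples of a non-reduced monomial are non-reduced. By minimality of generated ideals,
  this ideal bounds \<open>trunc_ideal\<close> from above.\<close>

lemma ideal_nonreduced:
  "ideal {p \<in> carrier (mpoly_algebra n). \<forall>m\<in>Poly_Mapping.keys p. \<not> reduced q n m}
     (mpoly_algebra n :: ('a::field, 'a mpoly) module)"
    (is "ideal ?J ?M")
proof -
  interpret M: algebra ring_of_type_algebra ?M by (rule algebra_mpoly)
  have J_mult: "x * p \<in> ?J" if p: "p \<in> ?J" and x: "x \<in> carrier ?M" for p x
  proof -
    have "\<not> reduced q n m" if m: "m \<in> Poly_Mapping.keys (x * p)" for m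
    proof -
      obtain a b where "b \<in> Poly_Mapping.keys p" "m = a + b"
        using m keys_mult[of x p] by auto
      then show ?thesis using p reduced_addD[of q n b a] by (auto simp: add.commute)
    qed
    moreover have "x * p \<in> carrier ?M" using M.m_closed[OF x, of p] p by (simp add: mpoly_algebra_simps(2))
    ultimately show ?thesis by simp
  qed
  show ?thesis
  proof (rule idealI)
    show "ring ?M" by (rule M.ring_axioms)
    show "subgroup ?J (add_monoid ?M)"
    proof (rule subgroup.intro)
      fix x y assume "x \<in> ?J" "y \<in> ?J"
      then show "x \<otimes>\<^bsub>add_monoid ?M\<^esub> y \<in> ?J"
        using Poly_Mapping.keys_add[of x y] by (fastforce simp: mpoly_algebra_simps)
    next
      fix x assume "x \<in> ?J"
      then show "inv\<^bsub>add_monoid ?M\<^esub> x \<in> ?J" by (simp add: uminus_mpoly_algebra) (simp add: mpoly_algebra_simps)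
    qed (auto simp: mpoly_algebra_simps)
    fix a x assume *: "a \<in> ?J" "x \<in> carrier ?M"
    show "x \<otimes>\<^bsub>?M\<^esub> a \<in> ?J" using J_mult[OF *] by (simp only: mpoly_algebra_simps)
    show "a \<otimes>\<^bsub>?M\<^esub> x \<in> ?J" using J_mult[OF *] by (simp only: mpoly_algebra_simps mult.commute[of a])
  qed
qed

lemma mvar_power_in_trunc_ideal:
  assumes "j \<in> {1..n}"
  shows "mvar j ^ q \<in> (trunc_ideal q n :: 'a::field mpoly set)"
proof -
  interpret M: algebra ring_of_type_algebra "mpoly_algebra n :: ('a::field, 'a mpoly) module"
    by (rule algebra_mpoly)
  have "{mvar j ^ q |j. j \<in> {1..n}} \<subseteq> carrier (mpoly_algebra n :: ('a::field, 'a mpoly) module)"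
    by (auto simp: mpoly_algebra_simps mvar_power split: if_splits)
  from M.genideal_self[OF this] show ?thesis using assms unfolding trunc_ideal_def by blast
qed

text \<open>Some variable has exponent at least \<open>q\<close>, so one of the generating powers
  can be split off.\<close>

lemma single_in_trunc_ideal:
  assumes "Poly_Mapping.keys m \<subseteq> {1..n}" "\<not> reduced q n m"
  shows "Poly_Mapping.single m c \<in> (trunc_ideal q n :: 'a::field mpoly set)"
proof -
  obtain j where j: "j \<in> {1..n}" "q \<le> Poly_Mapping.lookup m j"
    using assms by (auto simp: reduced_def not_less)
  let ?m = "m - Poly_Mapping.single j q"
  have m: "m = ?m + Poly_Mapping.single j q"
    using j by (intro poly_mapping_eqI) (auto simp: lookup_add lookup_minus lookup_single when_def)
  have "Poly_Mapping.keys ?m \<subseteq> {1..n}"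
    using assms(1) by (auto simp: in_keys_iff lookup_minus subset_iff)
  then have "Poly_Mapping.single ?m c \<in> carrier (mpoly_algebra n)" by (simp add: mpoly_algebra_simps)
  from trunc_ideal_mult[OF mvar_power_in_trunc_ideal[OF j(1), of q] this]
  show ?thesis by (simp add: mvar_power mult_single flip: m)
qed

text \<open>Membership can be tested monomial by monomial: one direction is minimality of the
  generated ideal, the other writes \<open>p\<close> as the sum of its terms. Thus a residue class
  is determined by its reduced coefficients.\<close>

lemma trunc_ideal_iff:
  fixes p :: "'a::field mpoly"
  assumes "p \<in> carrier (mpoly_algebra n)"
  shows "p \<in> trunc_ideal q n \<longleftrightarrow> (\<forall>m\<in>Poly_Mapping.keys p. \<not> reduced q n m)"
proof
  interpret M: algebra ring_of_type_algebra "mpoly_algebra n :: ('a::field, 'a mpoly) module"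
    by (rule algebra_mpoly)
  let ?J = "{p \<in> carrier (mpoly_algebra n :: ('a, 'a mpoly) module). \<forall>m\<in>Poly_Mapping.keys p. \<not> reduced q n m}"
  have "{mvar j ^ q |j. j \<in> {1..n}} \<subseteq> ?J"
  proof clarify
    fix j assume "j \<in> {1..n}"
    moreover have "Poly_Mapping.lookup (Poly_Mapping.single j q) j = q" by simp
    ultimately show "mvar j ^ q \<in> carrier (mpoly_algebra n :: ('a, 'a mpoly) module) \<and>
        (\<forall>m\<in>Poly_Mapping.keys (mvar j ^ q :: 'a mpoly). \<not> reduced q n m)"
      unfolding reduced_def mvar_power by (auto simp: mpoly_algebra_simps intro!: bexI[of _ j])
  qed
  then have "trunc_ideal q n \<subseteq> ?J"
    unfolding trunc_ideal_def by (intro M.genideal_minimal ideal_nonreduced)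
  then show "\<forall>m\<in>Poly_Mapping.keys p. \<not> reduced q n m" if "p \<in> trunc_ideal q n" using that by blast
next
  assume *: "\<forall>m\<in>Poly_Mapping.keys p. \<not> reduced q n m"
  have "(\<Sum>m\<in>K. Poly_Mapping.single m (Poly_Mapping.lookup p m)) \<in> trunc_ideal q n"
    if "finite K" "K \<subseteq> Poly_Mapping.keys p" for K
    using that
  proof (induction K rule: finite_induct)
    case (insert m K)
    then have "Poly_Mapping.single m (Poly_Mapping.lookup p m) \<in> trunc_ideal q n"
      using * assms by (intro single_in_trunc_ideal) (auto simp: mpoly_algebra_simps)
    then show ?case using insert by (simp add: trunc_ideal_add)
  qed (simp add: trunc_ideal_zero)
  from this[of "Poly_Mapping.keys p"] show "p \<in> trunc_ideal q n" by (simp add: poly_mapping_sum_single)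
qed

section \<open>Computing with residue classes\<close>

definition residue_class :: "nat \<Rightarrow> nat \<Rightarrow> 'a::field mpoly \<Rightarrow> 'a mpoly set"
  where "residue_class q n p = trunc_ideal q n +>\<^bsub>mpoly_algebra n\<^esub> p"

lemma in_residue_class_iff: "x \<in> residue_class q n p \<longleftrightarrow> x - p \<in> trunc_ideal q n"
proof -
  have "x \<in> residue_class q n p \<longleftrightarrow> (\<exists>h\<in>trunc_ideal q n. x = h + p)"
    unfolding residue_class_def a_r_coset_def' mpoly_algebra_simps by blast
  also have "\<dots> \<longleftrightarrow> x - p \<in> trunc_ideal q n"
    by (metis add_diff_cancel_right' diff_add_cancel)
  finally show ?thesis .
qed

lemma residue_class_eq_iff: "residue_class q n p = residue_class q n r \<longleftrightarrow> p - r \<in> trunc_ideal q n"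
proof
  assume "residue_class q n p = residue_class q n r"
  moreover have "p \<in> residue_class q n p" by (simp add: in_residue_class_iff trunc_ideal_zero)
  ultimately show "p - r \<in> trunc_ideal q n" by (simp add: in_residue_class_iff)
next
  assume *: "p - r \<in> trunc_ideal q n"
  show "residue_class q n p = residue_class q n r"
  proof (rule Set.set_eqI)
    fix x
    show "x \<in> residue_class q n p \<longleftrightarrow> x \<in> residue_class q n r"
      using trunc_ideal_add[OF _ *, of "x - p"] trunc_ideal_add[OF _ trunc_ideal_uminus[OF *], of "x - r"]
      by (auto simp: in_residue_class_iff)
  qed
qed

lemma carrier_trunc_algebra: "carrier (trunc_algebra q n) = residue_class q n ` carrier (mpoly_algebra n)"
  by (auto simp: trunc_algebra_def quot_algebra_def FactRing_def A_RCOSETS_def' residue_class_def)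

lemma trunc_algebra_ops:
  fixes p r :: "'a::field mpoly"
  assumes "p \<in> carrier (mpoly_algebra n)" "r \<in> carrier (mpoly_algebra n)"
  shows "residue_class q n p \<otimes>\<^bsub>trunc_algebra q n\<^esub> residue_class q n r = residue_class q n (p * r)"
    and "residue_class q n p \<oplus>\<^bsub>trunc_algebra q n\<^esub> residue_class q n r = residue_class q n (p + r)"
  using ideal.rcoset_mult_add[OF trunc_ideal assms] ideal.a_rcos_sum[OF trunc_ideal assms]
  by (simp_all add: trunc_algebra_def quot_algebra_def FactRing_def residue_class_def mpoly_algebra_simps)

text \<open>Scalar multiplication in the quotient is a union over all representatives. It collapses
  to one class because scaled representatives still differ by elements of the ideal.\<close>

lemma trunc_algebra_smult:
  fixes p :: "'a::field mpoly"
  shows "c \<odot>\<^bsub>trunc_algebra q n\<^esub> residue_class q n p = residue_class q n (Poly_Mapping.single 0 c * p)"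
proof -
  have "residue_class q n (Poly_Mapping.single 0 c * x) = residue_class q n (Poly_Mapping.single 0 c * p)"
    if "x \<in> residue_class q n p" for x
    using that trunc_ideal_mult[OF _ constant_in_carrier, of "x - p" q n c]
    by (simp add: residue_class_eq_iff in_residue_class_iff right_diff_distrib)
  moreover have "p \<in> residue_class q n p" by (simp add: in_residue_class_iff trunc_ideal_zero)
  ultimately have "(\<Union>x\<in>residue_class q n p. residue_class q n (Poly_Mapping.single 0 c * x)) =
      residue_class q n (Poly_Mapping.single 0 c * p)" by blast
  then show ?thesis
    by (simp add: trunc_algebra_def quot_algebra_def residue_class_def mpoly_algebra_simps)
qed

lemma trunc_algebra_one: "\<one>\<^bsub>trunc_algebra q n\<^esub> = residue_class q n 1"
  by (simp add: trunc_algebra_def quot_algebra_def FactRing_def residue_class_def mpoly_algebra_simps)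

lemma trunc_algebra_zero: "\<zero>\<^bsub>trunc_algebra q n\<^esub> = residue_class q n 0"
proof -
  have "\<zero>\<^bsub>trunc_algebra q n\<^esub> = trunc_ideal q n"
    by (simp add: trunc_algebra_def quot_algebra_def FactRing_def)
  then show ?thesis by (simp add: Set.set_eq_iff in_residue_class_iff)
qed

section \<open>The algebra \<open>A(q,n,e)\<close> in terms of weights\<close>

definition graded_mpolys :: "nat \<Rightarrow> nat \<Rightarrow> nat \<Rightarrow> 'a::field mpoly set"
  where "graded_mpolys q n e =
    {p \<in> carrier (mpoly_algebra n). \<forall>m\<in>Poly_Mapping.keys p. e dvd weight q n m}"

lemma graded_mpolys_single:
  "Poly_Mapping.keys m \<subseteq> {1..n} \<Longrightarrow> e dvd weight q n m \<Longrightarrow> Poly_Mapping.single m c \<in> graded_mpolys q n e"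
  by (simp add: graded_mpolys_def mpoly_algebra_simps)

lemma graded_mpolys_constant: "Poly_Mapping.single 0 c \<in> graded_mpolys q n e"
  by (rule graded_mpolys_single) (simp_all add: weight_def)

lemma graded_mpolys_add:
  "p \<in> graded_mpolys q n e \<Longrightarrow> r \<in> graded_mpolys q n e \<Longrightarrow> p + r \<in> graded_mpolys q n e"
  using Poly_Mapping.keys_add[of p r] by (simp add: graded_mpolys_def mpoly_algebra_simps) blast

lemma graded_mpolys_uminus: "p \<in> graded_mpolys q n e \<Longrightarrow> - p \<in> graded_mpolys q n e"
  by (simp add: graded_mpolys_def mpoly_algebra_simps)

lemma graded_mpolys_mult:
  assumes "p \<in> graded_mpolys q n e" "r \<in> graded_mpolys q n e"
  shows "p * r \<in> graded_mpolys q n e"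
proof -
  have "e dvd weight q n m" if m: "m \<in> Poly_Mapping.keys (p * r)" for m
  proof -
    obtain a b where "a \<in> Poly_Mapping.keys p" "b \<in> Poly_Mapping.keys r" "m = a + b"
      using m keys_mult[of p r] by auto
    then show ?thesis using assms by (simp add: graded_mpolys_def weight_add)
  qed
  then show ?thesis
    using assms keys_vars_mult[of p "{1..n}" r] by (simp add: graded_mpolys_def mpoly_algebra_simps)
qed

lemma graded_mpolys_sum: "(\<And>i. i \<in> J \<Longrightarrow> f i \<in> graded_mpolys q n e) \<Longrightarrow> sum f J \<in> graded_mpolys q n e"
  using graded_mpolys_constant[of 0 q n e]
  by (induction J rule: infinite_finite_induct) (auto intro: graded_mpolys_add)

lemma graded_mpolys_carrier: "p \<in> graded_mpolys q n e \<Longrightarrow> p \<in> carrier (mpoly_algebra n)"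
  by (simp add: graded_mpolys_def)

lemma A_gens_eq:
  "A_gens q n e = {residue_class q n (Poly_Mapping.single m (1::'a::field)) | m.
     Poly_Mapping.keys m \<subseteq> {1..n} \<and> e dvd weight q n m}" (is "_ = ?B")
proof (intro Set.set_eqI iffI)
  fix x :: "'a mpoly set" assume "x \<in> A_gens q n e"
  then obtain i where "x = residue_class q n (Poly_Mapping.single (exponents n i) 1)"
      "e dvd weight q n (exponents n i)"
    unfolding A_gens_def prod_mvar_power residue_class_def weight_exponents cong_0_iff by blast
  then show "x \<in> ?B" using keys_exponents by blast
next
  fix x :: "'a mpoly set" assume "x \<in> ?B"
  then obtain m where m: "x = residue_class q n (Poly_Mapping.single m 1)"
      "Poly_Mapping.keys m \<subseteq> {1..n}" "e dvd weight q n m" by blast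
  then show "x \<in> A_gens q n e"
    unfolding A_gens_def prod_mvar_power residue_class_def
    by (intro CollectI exI[of _ "Poly_Mapping.lookup m"]) (simp add: exponents_lookup weight_def cong_0_iff)
qed

text \<open>Weights are additive, so the classes on the right form a subalgebra containing the
  generators. Conversely, each of them is a sum of scalar multiples of generators and lies in every
  such subalgebra.\<close>

lemma gen_subalgebra_A_gens:
  "gen_subalgebra ring_of_type_algebra (trunc_algebra q n) (A_gens q n e) =
     (residue_class q n ` graded_mpolys q n e :: 'a::field mpoly set set)" (is "?G = ?B")
proof
  let ?T = "trunc_algebra q n :: ('a, 'a mpoly set) module"
  interpret T: algebra ring_of_type_algebra ?T by (rule algebra_trunc)
  note car = graded_mpolys_carrier
  have sub: "?B \<subseteq> carrier ?T" using car by (auto simp: carrier_trunc_algebra intro!: imageI)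
  have zero: "\<zero>\<^bsub>?T\<^esub> \<in> ?B" using graded_mpolys_constant[of "0::'a" q n e] by (simp add: trunc_algebra_zero imageI)
  have one: "\<one>\<^bsub>?T\<^esub> \<in> ?B" using graded_mpolys_constant[of "1::'a" q n e] by (simp add: trunc_algebra_one imageI)
  have minus: "\<ominus>\<^bsub>?T\<^esub> x \<in> ?B" if x: "x \<in> ?B" for x
  proof -
    obtain p where p: "p \<in> graded_mpolys q n e" "x = residue_class q n p" using x by blast
    have "\<ominus>\<^bsub>?T\<^esub> x = residue_class q n (- p)"
      using p sub car[OF p(1)] car[OF graded_mpolys_uminus[OF p(1)]]
      by (intro T.minus_equality) (auto simp: carrier_trunc_algebra trunc_algebra_ops trunc_algebra_zero imageI)
    then show ?thesis using graded_mpolys_uminus[OF p(1)] by (simp add: imageI)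
  qed
  have add: "x \<oplus>\<^bsub>?T\<^esub> y \<in> ?B" if "x \<in> ?B" "y \<in> ?B" for x y
    using that by (auto simp: trunc_algebra_ops car intro!: imageI graded_mpolys_add)
  have mult: "x \<otimes>\<^bsub>?T\<^esub> y \<in> ?B" if "x \<in> ?B" "y \<in> ?B" for x y
    using that by (auto simp: trunc_algebra_ops car intro!: imageI graded_mpolys_mult)
  have smult: "c \<odot>\<^bsub>?T\<^esub> x \<in> ?B" if "x \<in> ?B" for c x
    using that by (auto simp: trunc_algebra_smult intro!: imageI graded_mpolys_mult graded_mpolys_constant)
  have "submodule ?B ring_of_type_algebra ?T"
    using sub zero minus add smult by (rule T.submoduleI)
  moreover have "subring ?B ?T" using sub one minus mult add by (rule T.subringI)
  moreover have "A_gens q n e \<subseteq> ?B" unfolding A_gens_eq by (auto intro!: imageI graded_mpolys_single)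
  ultimately show "?G \<subseteq> ?B" unfolding gen_subalgebra_def by blast
  show "?B \<subseteq> ?G" unfolding gen_subalgebra_def
  proof (intro Inter_greatest)
    fix B assume "B \<in> {B. submodule B ring_of_type_algebra ?T \<and> subring B ?T \<and> A_gens q n e \<subseteq> B}"
    then have B: "submodule B ring_of_type_algebra ?T" "subring B ?T" "A_gens q n e \<subseteq> B" by auto
    have single: "residue_class q n (Poly_Mapping.single m c) \<in> B"
      if "Poly_Mapping.keys m \<subseteq> {1..n}" "e dvd weight q n m" for m c
    proof -
      have "residue_class q n (Poly_Mapping.single m 1) \<in> B" using that B(3) unfolding A_gens_eq by blast
      then have "c \<odot>\<^bsub>?T\<^esub> residue_class q n (Poly_Mapping.single m 1) \<in> B"
        by (intro submodule.smult_closed[OF B(1)]) (simp_all add: ring_of_type_algebra_def)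
      then show ?thesis by (simp add: trunc_algebra_smult mult_single)
    qed
    show "?B \<subseteq> B"
    proof clarify
      fix p :: "'a mpoly" assume p: "p \<in> graded_mpolys q n e"
      let ?f = "\<lambda>m. Poly_Mapping.single m (Poly_Mapping.lookup p m)"
      have "residue_class q n (sum ?f K) \<in> B" if "finite K" "K \<subseteq> Poly_Mapping.keys p" for K
        using that
      proof (induction K rule: finite_induct)
        case empty
        then show ?case using subringE(2)[OF B(2)] by (simp add: trunc_algebra_zero)
      next
        case (insert m K)
        have f: "?f m \<in> graded_mpolys q n e" if "m \<in> Poly_Mapping.keys p" for m
          using that p by (intro graded_mpolys_single) (auto simp: graded_mpolys_def mpoly_algebra_simps)
        have "residue_class q n (?f m) \<in> B"
          using insert.prems p by (intro single) (auto simp: graded_mpolys_def mpoly_algebra_simps)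
        then have "residue_class q n (?f m) \<oplus>\<^bsub>?T\<^esub> residue_class q n (sum ?f K) \<in> B"
          using insert by (intro subringE(7)[OF B(2)]) auto
        moreover have "sum ?f K \<in> graded_mpolys q n e" "?f m \<in> graded_mpolys q n e"
          using insert.prems f by (auto intro!: graded_mpolys_sum)
        ultimately show ?case using insert.hyps by (simp add: trunc_algebra_ops car)
      qed
      from this[of "Poly_Mapping.keys p"] show "residue_class q n p \<in> B" by (simp add: poly_mapping_sum_single)
    qed
  qed
qed

lemma carrier_A_algebra: "carrier (A_algebra q n e) = residue_class q n ` graded_mpolys q n e"
  by (simp add: A_algebra_def gen_subalgebra_A_gens)


section \<open>The multiplication table\<close>

text \<open>In the application, \<open>f k\<close> is the coefficient of the reduced monomial whose exponents are the
  base \<open>q\<close> digits of \<open>k * e\<close>.\<close>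

definition graded_model :: "nat \<Rightarrow> (nat \<Rightarrow> nat \<Rightarrow> bool) \<Rightarrow> ('a::field, nat \<Rightarrow> 'a) module"
  where "graded_model z C =
    \<lparr>carrier = {f. \<forall>k>z. f k = 0},
     monoid.mult = (\<lambda>f g k. if k \<le> z then \<Sum>i\<le>k. if C i (k - i) then f i * g (k - i) else 0 else 0),
     one = (\<lambda>k. if k = 0 then 1 else 0), ring.zero = (\<lambda>k. 0), add = (\<lambda>f g k. f k + g k),
     module.smult = (\<lambda>c f k. c * f k)\<rparr>"

text \<open>The isomorphism is \<open>f\<close> followed by the inverse of \<open>g\<close>; its
  linearity follows from that of \<open>f\<close> and \<open>g\<close> by injectivity of
  \<open>g\<close>. The algebra laws are asked of \<open>B\<close> and not of \<open>M\<close>, so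
  the multiplication table never has to be proved associative.\<close>

lemma algebra_isomorphic_via:
  assumes f: "f \<in> ring_iso A M" "\<And>c x. c \<in> carrier R \<Longrightarrow> x \<in> carrier A \<Longrightarrow> f (c \<odot>\<^bsub>A\<^esub> x) = c \<odot>\<^bsub>M\<^esub> f x"
    and g: "g \<in> ring_iso B M" "\<And>c x. c \<in> carrier R \<Longrightarrow> x \<in> carrier B \<Longrightarrow> g (c \<odot>\<^bsub>B\<^esub> x) = c \<odot>\<^bsub>M\<^esub> g x"
    and B: "algebra R B"
  shows "algebra_isomorphic R A B"
proof -
  interpret B: algebra R B by (rule B)
  let ?h = "inv_into (carrier B) g"
  have bij: "bij_betw g (carrier B) (carrier M)" by (rule ring_iso_memE(5)[OF g(1)])
  have "?h \<in> ring_iso M B" by (rule ring_iso_set_sym[OF B.ring_axioms g(1)])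
  then have "?h \<circ> f \<in> ring_iso A B" by (rule ring_iso_set_trans[OF f(1)])
  moreover have "(?h \<circ> f) (c \<odot>\<^bsub>A\<^esub> x) = c \<odot>\<^bsub>B\<^esub> (?h \<circ> f) x" if c: "c \<in> carrier R" and x: "x \<in> carrier A" for c x
  proof -
    have fx: "f x \<in> carrier M" using ring_iso_memE(1)[OF f(1)] x by blast
    have hx: "?h (f x) \<in> carrier B" and "g (?h (f x)) = f x"
      using fx bij by (auto simp: bij_betw_def inv_into_into f_inv_into_f)
    then have "g (c \<odot>\<^bsub>B\<^esub> ?h (f x)) = f (c \<odot>\<^bsub>A\<^esub> x)" using f(2) g(2) c x by simp
    then have "?h (f (c \<odot>\<^bsub>A\<^esub> x)) = c \<odot>\<^bsub>B\<^esub> ?h (f x)"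
      using bij B.smult_closed[OF c hx] by (metis bij_betw_def inv_into_f_f)
    then show ?thesis by simp
  qed
  ultimately show ?thesis unfolding algebra_isomorphic_def by blast
qed

section \<open>The monomial basis\<close>

locale bracket =
  fixes q n z e :: nat
  assumes q: "q > 1" and n: "n > 0" and ez: "e * z = q ^ n - 1"
begin

lemma e_pos: "e > 0"
proof -
  have "q ^ n > 1" using q n by (rule one_less_power)
  then show ?thesis using ez by (cases e) auto
qed

lemma power_eq: "q ^ n = e * z + 1"
proof -
  have "q ^ n > 0" using q by simp
  then show ?thesis using ez by linarith
qed

definition basis :: "nat \<Rightarrow> nat \<Rightarrow>\<^sub>0 nat"
  where "basis k = digits q n (k * e)"

lemma reduced_basis: "reduced q n (basis k)"
  unfolding basis_def using q by (intro reduced_digits) simp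

lemma keys_basis: "Poly_Mapping.keys (basis k) \<subseteq> {1..n}"
  using reduced_basis by (simp add: reduced_def)

lemma weight_basis:
  assumes "k \<le> z"
  shows "weight q n (basis k) = k * e"
proof -
  have "k * e \<le> z * e" using assms by (rule mult_le_mono1)
  then have "k * e < q ^ n" unfolding power_eq mult.commute[of e z] by linarith
  then show ?thesis by (simp add: basis_def weight_digits)
qed

lemma inj_on_basis: "inj_on basis {..z}"
proof (rule inj_onI)
  fix k l assume "k \<in> {..z}" "l \<in> {..z}" "basis k = basis l"
  then have "k * e = l * e" by (metis atMost_iff weight_basis)
  then show "k = l" using e_pos by simp
qed

lemma basis_0: "basis 0 = 0"
  by (simp add: basis_def digits_def exponents_def)

text \<open>The weight of a reduced monomial is below \<open>q ^ n = e * z + 1\<close>, so a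
  multiple of \<open>e\<close> among these weights is \<open>k * e\<close> with \<open>k\<close> at
  most \<open>z\<close>, and the weight determines the monomial.\<close>

lemma reduced_imp_basis:
  assumes "reduced q n m" "e dvd weight q n m"
  obtains k where "k \<le> z" "m = basis k"
proof -
  obtain k where k: "weight q n m = k * e" using assms(2) by (metis dvd_div_mult_self)
  have "e * k < e * z + 1" using weight_less[OF assms(1)] k by (simp add: power_eq mult.commute)
  then have "e * k \<le> e * z" by linarith
  then have "k \<le> z" using e_pos by simp
  then show thesis using that digits_weight[OF assms(1)] k by (simp add: basis_def)
qed

lemma reduced_basis_add_iff:
  assumes "k \<le> z" "l \<le> z"
  shows "reduced q n (basis k + basis l) \<longleftrightarrow> compatible q z k l"
proof -
  have "q > 0" using q by simp
  then show ?thesis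
    unfolding basis_def reduced_add_digits_iff
    by (simp only: no_carry_iff no_carry_iff_compatible[OF q ez e_pos n assms])
qed

text \<open>Without carries the digitwise sum is again reduced, hence it is the digit vector of its
  weight \<open>(k + l) * e\<close>.\<close>

lemma basis_add:
  assumes "k \<le> z" "l \<le> z" "compatible q z k l"
  shows "basis k + basis l = basis (k + l)"
proof -
  have "reduced q n (basis k + basis l)" using assms by (simp add: reduced_basis_add_iff)
  from digits_weight[OF this] show ?thesis
    using assms by (simp only: weight_add weight_basis) (simp only: basis_def distrib_right)
qed

text \<open>Factors of a reduced monomial are reduced. Having weights divisible by \<open>e\<close>,
  they are basis monomials, and comparing weights shows that their indices add up to
  \<open>k\<close>.\<close>

lemma lookup_times_basis:
  fixes p r :: "'a::field mpoly"
  assumes p: "p \<in> graded_mpolys q n e" and r: "r \<in> graded_mpolys q n e" and k: "k \<le> z"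
  shows "Poly_Mapping.lookup (p * r) (basis k) =
    (\<Sum>i\<le>k. if compatible q z i (k - i)
       then Poly_Mapping.lookup p (basis i) * Poly_Mapping.lookup r (basis (k - i)) else 0)"
proof -
  let ?I = "{i \<in> {..k}. compatible q z i (k - i)}" and ?f = "\<lambda>i. (basis i, basis (k - i))"
  let ?g = "\<lambda>(a, b). if a + b = basis k then Poly_Mapping.lookup p a * Poly_Mapping.lookup r b else 0"
  have "Poly_Mapping.lookup (p * r) (basis k) = sum ?g (Poly_Mapping.keys p \<times> Poly_Mapping.keys r)"
    by (rule lookup_times_eq_sum)
  also have "\<dots> = sum ?g (?f ` ?I)"
  \<comment> \<open>In general neither index set contains the other: pairs of the supports outside
    the image do not add up to \<open>basis k\<close>, and pairs of the image outside the supports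
    have a zero coefficient.\<close>
  proof (rule sum.mono_neutral_cong)
    fix x assume x: "x \<in> Poly_Mapping.keys p \<times> Poly_Mapping.keys r - ?f ` ?I"
    obtain a b where ab: "x = (a, b)" by (cases x)
    have "a + b \<noteq> basis k"
    proof
      assume eq: "a + b = basis k"
      have red: "reduced q n a" "reduced q n b"
        using reduced_addD[of q n a b] reduced_addD[of q n b a] reduced_basis[of k]
        by (simp_all add: eq add.commute[of b])
      have "e dvd weight q n a" "e dvd weight q n b"
        using x p r by (auto simp: ab graded_mpolys_def)
      then obtain i l where i: "i \<le> z" "a = basis i" and l: "l \<le> z" "b = basis l"
        using reduced_imp_basis red by metis
      have "compatible q z i l" using reduced_basis_add_iff[OF i(1) l(1)] eq i l reduced_basis by metis
      moreover have "i * e + l * e = k * e"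
        using arg_cong[OF eq, of "weight q n"] i l k by (simp add: weight_add weight_basis)
      then have "k = i + l" using e_pos by (simp flip: distrib_right)
      ultimately have "x \<in> ?f ` ?I" using ab i l by (intro image_eqI[of _ _ i]) auto
      then show False using x by blast
    qed
    then show "?g x = 0" by (simp add: ab)
  next
    fix x assume "x \<in> ?f ` ?I - Poly_Mapping.keys p \<times> Poly_Mapping.keys r"
    then show "?g x = 0" by (auto simp: in_keys_iff split: if_splits)
  qed auto
  also have "\<dots> = sum (?g \<circ> ?f) ?I"
    using k by (intro sum.reindex inj_onI inj_onD[OF inj_on_basis]) auto
  also have "\<dots> = (\<Sum>i\<in>?I. Poly_Mapping.lookup p (basis i) * Poly_Mapping.lookup r (basis (k - i)))"
    using k by (intro sum.cong) (auto simp: basis_add)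
  also have "\<dots> = (\<Sum>i\<le>k. if compatible q z i (k - i)
       then Poly_Mapping.lookup p (basis i) * Poly_Mapping.lookup r (basis (k - i)) else 0)"
    by (rule sum.inter_filter) simp
  finally show ?thesis .
qed

section \<open>Coordinates with respect to the basis\<close>

definition basis_coeffs :: "'a::field mpoly set \<Rightarrow> nat \<Rightarrow> 'a"
  where "basis_coeffs x k = (if k \<le> z then Poly_Mapping.lookup (SOME p. p \<in> x) (basis k) else 0)"

text \<open>The arbitrary choice of a representative is harmless: two of them differ by an element
  of the ideal, in which no reduced monomial occurs.\<close>

lemma basis_coeffs_residue_class:
  fixes p :: "'a::field mpoly"
  shows "basis_coeffs (residue_class q n p) k = (if k \<le> z then Poly_Mapping.lookup p (basis k) else 0)"
proof -
  let ?x = "SOME x. x \<in> residue_class q n p"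
  have "p \<in> residue_class q n p" by (simp add: in_residue_class_iff trunc_ideal_zero)
  then have "?x \<in> residue_class q n p" by (rule someI)
  then have "?x - p \<in> trunc_ideal q n" by (simp add: in_residue_class_iff)
  moreover from this have "?x - p \<in> carrier (mpoly_algebra n)" using trunc_ideal_subset by blast
  ultimately have "basis k \<notin> Poly_Mapping.keys (?x - p)" using trunc_ideal_iff reduced_basis by metis
  then show ?thesis by (simp add: basis_coeffs_def in_keys_iff lookup_minus)
qed

text \<open>If all coordinates agree, the difference of two graded lifts has only non-reduced
  monomials and lies in the ideal. For surjectivity, the given coordinates serve as coefficients of
  the basis monomials.\<close>

lemma bij_betw_basis_coeffs:
  "bij_betw basis_coeffs (carrier (A_algebra q n e :: ('a::field, 'a mpoly set) module))
     (carrier (graded_model z (compatible q z) :: ('a, nat \<Rightarrow> 'a) module))"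
  unfolding bij_betw_def
proof
  let ?A = "A_algebra q n e :: ('a, 'a mpoly set) module"
  show "inj_on basis_coeffs (carrier ?A)"
  proof (rule inj_onI)
    fix x y assume "x \<in> carrier ?A" "y \<in> carrier ?A" and eq: "basis_coeffs x = basis_coeffs y"
    then obtain p r where p: "p \<in> graded_mpolys q n e" "x = residue_class q n p"
      and r: "r \<in> graded_mpolys q n e" "y = residue_class q n r"
      unfolding carrier_A_algebra by blast
    have s: "p - r \<in> graded_mpolys q n e"
      using graded_mpolys_add[OF p(1) graded_mpolys_uminus[OF r(1)]] by simp
    have "\<not> reduced q n m" if m: "m \<in> Poly_Mapping.keys (p - r)" for m
    proof
      assume "reduced q n m"
      moreover have "e dvd weight q n m" using m s by (simp add: graded_mpolys_def)
      ultimately obtain k where k: "k \<le> z" "m = basis k" by (rule reduced_imp_basis)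
      then have "Poly_Mapping.lookup p m = Poly_Mapping.lookup r m"
        using fun_cong[OF eq, of k] by (simp add: p r basis_coeffs_residue_class)
      then show False using m by (simp add: in_keys_iff lookup_minus)
    qed
    then show "x = y"
      using trunc_ideal_iff[OF graded_mpolys_carrier[OF s]] p r by (simp add: residue_class_eq_iff)
  qed
  show "basis_coeffs ` carrier ?A = carrier (graded_model z (compatible q z))"
  proof (intro equalityI subsetI)
    fix f :: "nat \<Rightarrow> 'a" assume "f \<in> carrier (graded_model z (compatible q z))"
    then have f: "f k = 0" if "k > z" for k using that by (simp add: graded_model_def)
    let ?p = "\<Sum>k\<le>z. Poly_Mapping.single (basis k) (f k)"
    have "?p \<in> graded_mpolys q n e"
      using keys_basis by (intro graded_mpolys_sum graded_mpolys_single) (simp_all add: weight_basis)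
    moreover have "Poly_Mapping.lookup ?p (basis k) = f k" if "k \<le> z" for k
    proof -
      have "Poly_Mapping.lookup ?p (basis k) = (\<Sum>l\<le>z. if l = k then f l else 0)"
        unfolding lookup_sum lookup_single when_def
        using that by (intro sum.cong) (auto dest: inj_onD[OF inj_on_basis])
      then show ?thesis using that by simp
    qed
    then have "basis_coeffs (residue_class q n ?p) = f"
      using f by (auto simp: basis_coeffs_residue_class fun_eq_iff)
    ultimately show "f \<in> basis_coeffs ` carrier ?A" unfolding carrier_A_algebra
      by (intro image_eqI[OF sym imageI])
  qed (auto simp: graded_model_def basis_coeffs_def)
qed

lemma A_algebra_ops:
  "monoid.mult (A_algebra q n e) = monoid.mult (trunc_algebra q n)"
  "add (A_algebra q n e) = add (trunc_algebra q n)"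
  "one (A_algebra q n e) = one (trunc_algebra q n)"
  "module.smult (A_algebra q n e) = module.smult (trunc_algebra q n)"
  by (simp_all add: A_algebra_def)

lemma basis_coeffs_ring_iso:
  "basis_coeffs \<in> ring_iso (A_algebra q n e :: ('a::field, 'a mpoly set) module) (graded_model z (compatible q z))"
proof (rule ring_iso_memI)
  let ?A = "A_algebra q n e :: ('a, 'a mpoly set) module"
  let ?M = "graded_model z (compatible q z) :: ('a, nat \<Rightarrow> 'a) module"
  show "basis_coeffs x \<in> carrier ?M" if "x \<in> carrier ?A" for x
    using that bij_betw_basis_coeffs by (auto simp: bij_betw_def)
  show "bij_betw basis_coeffs (carrier ?A) (carrier ?M)" by (rule bij_betw_basis_coeffs)
  show "basis_coeffs \<one>\<^bsub>?A\<^esub> = \<one>\<^bsub>?M\<^esub>"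
  proof
    fix k
    have "k \<le> z \<Longrightarrow> basis k = 0 \<longleftrightarrow> k = 0"
      using inj_on_eq_iff[OF inj_on_basis, of k 0] by (simp add: basis_0)
    then show "basis_coeffs \<one>\<^bsub>?A\<^esub> k = \<one>\<^bsub>?M\<^esub> k"
      by (auto simp: A_algebra_ops trunc_algebra_one basis_coeffs_residue_class graded_model_def lookup_one when_def)
  qed
  fix x y assume "x \<in> carrier ?A" "y \<in> carrier ?A"
  then obtain p r where p: "p \<in> graded_mpolys q n e" "x = residue_class q n p"
    and r: "r \<in> graded_mpolys q n e" "y = residue_class q n r"
    unfolding carrier_A_algebra by blast
  note car = graded_mpolys_carrier[OF p(1)] graded_mpolys_carrier[OF r(1)]
  show "basis_coeffs (x \<oplus>\<^bsub>?A\<^esub> y) = basis_coeffs x \<oplus>\<^bsub>?M\<^esub> basis_coeffs y"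
    by (simp add: fun_eq_iff A_algebra_ops p r trunc_algebra_ops car basis_coeffs_residue_class graded_model_def lookup_add)
  have "basis_coeffs (x \<otimes>\<^bsub>?A\<^esub> y) k = (basis_coeffs x \<otimes>\<^bsub>?M\<^esub> basis_coeffs y) k" for k
    by (auto simp: A_algebra_ops p(2) r(2) trunc_algebra_ops car basis_coeffs_residue_class graded_model_def
        lookup_times_basis[OF p(1) r(1)] intro!: sum.cong)
  then show "basis_coeffs (x \<otimes>\<^bsub>?A\<^esub> y) = basis_coeffs x \<otimes>\<^bsub>?M\<^esub> basis_coeffs y" ..
qed

lemma basis_coeffs_smult:
  fixes x :: "'a::field mpoly set"
  assumes "x \<in> carrier (A_algebra q n e)"
  shows "basis_coeffs (c \<odot>\<^bsub>A_algebra q n e\<^esub> x) = c \<odot>\<^bsub>graded_model z (compatible q z)\<^esub> basis_coeffs x"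
proof -
  obtain p where p: "x = residue_class q n p" using assms unfolding carrier_A_algebra by blast
  have "Poly_Mapping.lookup (Poly_Mapping.single 0 c * p) m = c * Poly_Mapping.lookup p m" for m
  proof -
    have "(\<Sum>(a, b)\<in>{0} \<times> Poly_Mapping.keys p.
        if a + b = m then Poly_Mapping.lookup (Poly_Mapping.single 0 c) a * Poly_Mapping.lookup p b else 0) =
      (\<Sum>b\<in>Poly_Mapping.keys p. if b = m then c * Poly_Mapping.lookup p b else 0)"
      by (simp flip: sum.cartesian_product)
    also have "\<dots> = c * Poly_Mapping.lookup p m" by (simp add: sum.delta' in_keys_iff)
    finally show ?thesis by (simp add: lookup_times_eq_sum)
  qed
  then show ?thesis
    by (simp add: fun_eq_iff p A_algebra_ops trunc_algebra_smult basis_coeffs_residue_class graded_model_def)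
qed

end

section \<open>Comparison of the two algebras\<close>

lemma bracketI:
  assumes "q > 1" "n > 0" "z dvd q ^ n - 1"
  shows "bracket q n z ((q ^ n - 1) div z)"
  using assms by unfold_locales simp_all

lemma A_bracket_isomorphic:
  assumes "z > 0" "q > 1" "Q > 1" "coprime q z" "coprime Q z"
    and eq: "residue_subgroup z q = residue_subgroup z Q" and n: "card (residue_subgroup z q) = n"
  shows "algebra_isomorphic ring_of_type_algebra
    (A_bracket q n z :: ('a::field, 'a mpoly set) module) (A_bracket Q n z)"
proof -
  \<comment> \<open>The subgroup contains the class of \<open>1\<close>, so its order
    \<open>n\<close> is positive, as \<open>bracket\<close> requires.\<close>
  have "ZMod (int z) (int q ^ 0) \<in> residue_subgroup z q"
    unfolding residue_subgroup_eq[OF assms(1,4)] by blast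
  then have "n > 0" using residue_subgroup_finite(2)[OF assms(1,4)] n by (auto simp: card_gt_0_iff)
  moreover have "z dvd q ^ n - 1" "z dvd Q ^ n - 1"
    using dvd_power_card_residue_subgroup[of z q] dvd_power_card_residue_subgroup[of z Q] assms by auto
  ultimately have br: "bracket q n z ((q ^ n - 1) div z)" "bracket Q n z ((Q ^ n - 1) div z)"
    using bracketI[of q n z] bracketI[of Q n z] assms(1-3) by simp_all
  \<comment> \<open>With equal relations, both algebras have the same \<open>graded_model\<close> as
    target.\<close>
  have comp: "compatible q z = compatible Q z"
    using compatible_mono[of z q Q] compatible_mono[of z Q q] assms by (auto simp: fun_eq_iff)
  show ?thesis
    unfolding A_bracket_def
    by (rule algebra_isomorphic_via[OF bracket.basis_coeffs_ring_iso[OF br(1)] bracket.basis_coeffs_smult[OF br(1)]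
        bracket.basis_coeffs_ring_iso[OF br(2), folded comp] bracket.basis_coeffs_smult[OF br(2), folded comp] algebra_A])
qed

theorem lemma7p5:
  fixes z q Q n :: nat
  assumes "z > 0" and "q > 1" and "Q > 1" and "coprime q z" and "coprime Q z"
  shows "(residue_subgroup z q = residue_subgroup z Q \<and> card (residue_subgroup z q) = n
           \<longrightarrow> algebra_isomorphic ring_of_type_algebra
                 (A_bracket q n z :: ('a::field, 'a mpoly set) module) (A_bracket Q n z))
       \<and> ([q = Q] (mod z) \<and> card (residue_subgroup z q) = n
           \<longrightarrow> algebra_isomorphic ring_of_type_algebra
                 (A_bracket q n z :: ('a::field, 'a mpoly set) module) (A_bracket Q n z))"
proof -
  \<comment> \<open>Congruent \<open>q\<close> and \<open>Q\<close> have the same residue class as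
    generator, so the second claim is a case of the first.\<close>
  have cong: "residue_subgroup z q = residue_subgroup z Q" if "[q = Q] (mod z)"
  proof -
    have "int q mod int z = int Q mod int z" using that by (simp add: cong_def flip: zmod_int)
    then have "ZMod (int z) (int q) = ZMod (int z) (int Q)" by (rule zmod_imp_ZMod)
    then show ?thesis by (simp add: residue_subgroup_def)
  qed
  note iso = A_bracket_isomorphic[OF assms]
  show ?thesis
    by (intro conjI impI; elim conjE)
      ((rule iso; assumption), (rule iso[OF cong]; assumption))
qed

end
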